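(* Fix $t\in[0,1]$. For each $n\ge 1$ let $T_{(1)}\le \dots\le T_{(n)}$ be the order statistics of $n$ independent random variables uniformly distributed on $[0,1]$, set $T_{(0)}:=0$, and let $T^n(t):=T_{(\lfloor nt\rfloor)}$. Then the sequence $\{T^n(t),\ n\ge 1\}$ satisfies the large deviations principle (LDP) in $[0,1]$ with good rate function $$I_t(x)=t\log\left(\frac{t}{x}\right)+(1-t)\log\left(\frac{1-t}{1-x}\right),\qquad x\in[0,1].$$
   Context: A rate function on a Hausdorff topological space $\mathcal X$ is a lower semicontinuous map $I:\mathcal X\to[0,\infty]$; it is good if all its level sets $\{x: I(x)\le\alpha\}$, $\alpha\in[0,\infty)$, are compact. A sequence of random elements $\{X_n\}$ of $\mathcal X$ satisfies the LDP with rate function $I$ if $\liminf_{n\to\infty}\frac1n\log\mathbb P(X_n\in G)\ge-\inf_{x\in G}I(x)$ for every open $G\subset\mathcal X$ and $\limsup_{n\to\infty}\frac1n\log\mathbb P(X_n\in F)\le-\inf_{x\in F}I(x)$ for every closed $F\subset\mathcal X$. Conventions in $I_t$: a term with zero coefficient ($t=0$ or $1-t=0$) is $0$, and a term $c\log(c/0)$ with $c>0$ is $+\infty$.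
   Formalization: For t=0 the LDP lower bound is dropped, since it is false there: T^n(0)=0 surely while I_0(x)=-log(1-x) is finite on (1/4,3/4); for t=0 only the good rate function, randomness in [0,1] and the upper bound are claimed, and for 0<t≤1 the full LDP. *)

theory Defs
  imports "HOL-Probability.Probability"
begin

definition rate_function :: "'a topology \<Rightarrow> ('a \<Rightarrow> ereal) \<Rightarrow> bool" where
  "rate_function X I \<longleftrightarrow>
     Hausdorff_space X \<and>
     (\<forall>x\<in>topspace X. 0 \<le> I x) \<and>
     (\<forall>a. openin X {x \<in> topspace X. a < I x})"

definition good_rate_function :: "'a topology \<Rightarrow> ('a \<Rightarrow> ereal) \<Rightarrow> bool" where
  "good_rate_function X I \<longleftrightarrow>
     rate_function X I \<and>
     (\<forall>\<alpha>::real. 0 \<le> \<alpha> \<longrightarrow> compactin X {x \<in> topspace X. I x \<le> ereal \<alpha>})"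

text \<open>Membership in the space is only required almost surely: a real random variable whose
  law is carried by the closed unit interval is to count as a random element of that interval.\<close>

definition random_element :: "'a topology \<Rightarrow> 'w measure \<Rightarrow> ('w \<Rightarrow> 'a) \<Rightarrow> bool" where
  "random_element X N f \<longleftrightarrow>
     prob_space N \<and>
     (\<forall>G. openin X G \<longrightarrow> {\<omega> \<in> space N. f \<omega> \<in> G} \<in> sets N) \<and>
     (AE \<omega> in N. f \<omega> \<in> topspace X)"

text \<open>The logarithm of a probability; note that the library has \<^term>\<open>ln 0 = (0::real)\<close>.\<close>

definition elog :: "real \<Rightarrow> ereal" where
  "elog p = (if p = 0 then -\<infinity> else ereal (ln p))"

definition log_prob_rate ::
    "(nat \<Rightarrow> 'w measure) \<Rightarrow> (nat \<Rightarrow> 'w \<Rightarrow> 'a) \<Rightarrow> 'a set \<Rightarrow> nat \<Rightarrow> ereal" where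
  "log_prob_rate M Y A n =
     ereal (1 / real n) * elog (measure (M n) {\<omega> \<in> space (M n). Y n \<omega> \<in> A})"

definition LDP_lower_bound ::
    "'a topology \<Rightarrow> (nat \<Rightarrow> 'w measure) \<Rightarrow> (nat \<Rightarrow> 'w \<Rightarrow> 'a) \<Rightarrow> ('a \<Rightarrow> ereal) \<Rightarrow> bool" where
  "LDP_lower_bound X M Y I \<longleftrightarrow>
     (\<forall>G. openin X G \<longrightarrow> - (INF x\<in>G. I x) \<le> liminf (log_prob_rate M Y G))"

definition LDP_upper_bound ::
    "'a topology \<Rightarrow> (nat \<Rightarrow> 'w measure) \<Rightarrow> (nat \<Rightarrow> 'w \<Rightarrow> 'a) \<Rightarrow> ('a \<Rightarrow> ereal) \<Rightarrow> bool" where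
  "LDP_upper_bound X M Y I \<longleftrightarrow>
     (\<forall>F. closedin X F \<longrightarrow> limsup (log_prob_rate M Y F) \<le> - (INF x\<in>F. I x))"

text \<open>Each \<^term>\<open>Y n\<close> may live on its own probability space \<^term>\<open>M n\<close>. The sequences start
  at \<^term>\<open>n = (1::nat)\<close>; nothing is required of the entry with index 0.\<close>

definition satisfies_LDP ::
    "'a topology \<Rightarrow> (nat \<Rightarrow> 'w measure) \<Rightarrow> (nat \<Rightarrow> 'w \<Rightarrow> 'a) \<Rightarrow> ('a \<Rightarrow> ereal) \<Rightarrow> bool" where
  "satisfies_LDP X M Y I \<longleftrightarrow>
     rate_function X I \<and>
     (\<forall>n\<ge>1. random_element X (M n) (Y n)) \<and>
     LDP_lower_bound X M Y I \<and>
     LDP_upper_bound X M Y I"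

text \<open>The \<open>k\<close>-th smallest of \<open>U 1 \<omega>, \<dots>, U n \<omega>\<close> for \<open>1 \<le> k \<le> n\<close>, and 0 for \<open>k = 0\<close>.\<close>

definition order_statistic :: "(nat \<Rightarrow> 'w \<Rightarrow> real) \<Rightarrow> nat \<Rightarrow> nat \<Rightarrow> 'w \<Rightarrow> real" where
  "order_statistic U n k \<omega> =
     (if k = 0 then 0 else sort (map (\<lambda>i. U i \<omega>) [1..<Suc n]) ! (k - 1))"

text \<open>The extended value of \<open>c log (c / y)\<close> for nonnegative \<open>c\<close> and \<open>y\<close>.\<close>

definition entropy_term :: "real \<Rightarrow> real \<Rightarrow> ereal" where
  "entropy_term c y =
     (if c = 0 then 0 else if y = 0 then \<infinity> else ereal (c * ln (c / y)))"

definition rate_I :: "real \<Rightarrow> real \<Rightarrow> ereal" where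
  "rate_I t x = entropy_term t x + entropy_term (1 - t) (1 - x)"

text \<open>For \<open>t = 0\<close> the variable in question is identically 0, whereas
  \<^term>\<open>rate_I 0 x\<close> is finite for \<open>0 \<le> x < 1\<close>. Hence the LDP lower bound fails in this
  degenerate case.\<close>

lemma LDP_lower_bound_fails_at_0:
  "\<not> LDP_lower_bound (top_of_set {0..1::real}) M
       (\<lambda>n. order_statistic (U n) n (nat \<lfloor>real n * 0\<rfloor>)) (rate_I 0)"
    (is "\<not> LDP_lower_bound ?X M ?Y _")
proof
  assume L: "LDP_lower_bound ?X M ?Y (rate_I 0)"
  let ?G = "{1/4<..<3/4::real}"
  have G: "openin ?X ?G"
    by (rule open_subset) auto
  have "log_prob_rate M ?Y ?G n = -\<infinity>" if "n \<ge> 1" for n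
    using that by (simp add: log_prob_rate_def order_statistic_def elog_def)
  then have "\<forall>\<^sub>F n in sequentially. log_prob_rate M ?Y ?G n = -\<infinity>"
    using eventually_sequentially by blast
  then have "liminf (log_prob_rate M ?Y ?G) = liminf (\<lambda>_. -\<infinity>)"
    by (rule Liminf_eq)
  then have lim: "liminf (log_prob_rate M ?Y ?G) = -\<infinity>"
    by (simp add: Liminf_const)
  have "(INF x\<in>?G. rate_I 0 x) \<le> rate_I 0 (1/2)"
    by (rule INF_lower) auto
  also have "\<dots> = ereal (ln 2)"
    by (simp add: rate_I_def entropy_term_def)
  finally have "(INF x\<in>?G. rate_I 0 x) \<noteq> \<infinity>"
    by auto
  moreover have "- (INF x\<in>?G. rate_I 0 x) \<le> liminf (log_prob_rate M ?Y ?G)"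
    by (rule L[unfolded LDP_lower_bound_def, rule_format, OF G])
  ultimately show False
    unfolding lim by (cases "INF x\<in>?G. rate_I 0 x") auto
qed

end

(* The k-th order statistic is at most x iff at least k of the n points are, and the number of
   these points is binomial. Replacing the success probability x by t multiplies the j-th binomial
   weight by a factor monotone in j, so the tail from k = [nt] away from nt has probability at most
   (x/t)^k ((1-x)/(1-t))^(n-k), which is exp(-n I_t(x)) to first exponential order. A closed set
   that misses t lies in two such tails, each ending at a point of the set. Conversely, (a,x]
   contains the k-th order statistic with at least a fixed multiple of the probability that exactly
   k points fall below x; the binomial coefficient is of the right exponential order because the
   binomial distribution with success probability k/n has mode k. *)

theory Submission
  imports Defs "HOL-Real_Asymp.Real_Asymp"
begin

section \<open>The rate function\<close>

text \<open>This is \<open>ln z \<le> z - 1\<close> at \<open>z = y / c\<close>. For the two terms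
  of the rate the lower bounds \<open>t - x\<close> and \<open>(1 - t) - (1 - x)\<close> add up to
  0, hence nonnegativity.\<close>

lemma entropy_term_ge:
  assumes "0 \<le> c" "0 \<le> y"
  shows "ereal (c - y) \<le> entropy_term c y"
proof (cases "c = 0 \<or> y = 0")
  case True
  then show ?thesis using assms by (auto simp: entropy_term_def)
next
  case False
  then have pos: "0 < c" "0 < y" using assms by auto
  have "ln (y / c) \<le> y / c - 1"
    using pos by (intro ln_le_minus_one) simp
  then have "c * ln (y / c) \<le> c * (y / c - 1)"
    using pos by (intro mult_left_mono) auto
  then have "c - y \<le> c * ln (c / y)"
    using pos by (simp add: ln_div algebra_simps)
  then show ?thesis using pos by (simp add: entropy_term_def)
qed

lemma entropy_term_not_MInfty: "entropy_term c y \<noteq> -\<infinity>"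
  by (simp add: entropy_term_def)

text \<open>Continuity is meant in the extended reals and includes the endpoint 0, where for
  positive \<open>c\<close> the term tends to its value \<infinity>.\<close>

lemma continuous_on_entropy_term:
  assumes "0 \<le> c"
  shows "continuous_on {0..} (entropy_term c)"
proof (cases "c = 0")
  case True
  then show ?thesis by (simp add: entropy_term_def)
next
  case False
  then have c: "0 < c" using assms by simp
  have "(entropy_term c \<longlongrightarrow> entropy_term c y) (at y within {0..})" if "0 \<le> y" for y
  proof (cases "y = 0")
    case True
    have "filterlim (\<lambda>y. c * ln (c / y)) at_top (at_right 0)"
      using c by real_asymp
    then have "((\<lambda>y. ereal (c * ln (c / y))) \<longlongrightarrow> \<infinity>) (at_right 0)"
      by (simp add: tendsto_PInfty_eq_at_top)
    moreover have "\<forall>\<^sub>F y in at_right 0. ereal (c * ln (c / y)) = entropy_term c y"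
      using c by (auto simp: entropy_term_def eventually_at_right_field intro!: exI[of _ 1])
    ultimately have "(entropy_term c \<longlongrightarrow> \<infinity>) (at_right 0)"
      by (rule Lim_transform_eventually)
    then show ?thesis using c True by (simp add: at_within_Ici_at_right entropy_term_def)
  next
    case False
    with that have y: "0 < y" by simp
    have "((\<lambda>y. ereal (c * ln (c / y))) \<longlongrightarrow> ereal (c * ln (c / y))) (at y)"
      using y c by (auto intro!: tendsto_intros)
    moreover have "\<forall>\<^sub>F z in at y. ereal (c * ln (c / z)) = entropy_term c z"
    proof -
      have "\<forall>\<^sub>F z in at y. z \<in> {0<..}"
        by (rule eventually_at_in_open') (use y in auto)
      then show ?thesis by eventually_elim (use c in \<open>auto simp: entropy_term_def\<close>)
    qed
    ultimately have "(entropy_term c \<longlongrightarrow> ereal (c * ln (c / y))) (at y)"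
      by (rule Lim_transform_eventually)
    then have "(entropy_term c \<longlongrightarrow> entropy_term c y) (at y)"
      using c y by (simp add: entropy_term_def)
    then show ?thesis by (rule tendsto_within_subset) simp
  qed
  then show ?thesis by (simp add: continuous_on_def)
qed

lemma continuous_on_rate_I:
  assumes "0 \<le> t" "t \<le> 1"
  shows "continuous_on {0..1} (rate_I t)"
proof -
  have f: "continuous_on {0..1} (entropy_term t)"
    by (rule continuous_on_subset[OF continuous_on_entropy_term]) (use assms in auto)
  have g: "continuous_on {0..1} (\<lambda>x. entropy_term (1 - t) (1 - x))"
    by (rule continuous_on_compose2[OF continuous_on_entropy_term])
       (use assms in \<open>auto intro!: continuous_intros\<close>)
  show ?thesis
    \<comment> \<open>Addition of extended reals is continuous away from \<infinity> +
      (-\<infinity>), and neither term ever takes the value -\<infinity>.\<close>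
    using f g unfolding continuous_on_def rate_I_def
    by (auto intro!: tendsto_add_ereal_general simp: entropy_term_not_MInfty)
qed

lemma rate_I_nonneg:
  assumes "0 \<le> t" "t \<le> 1" "0 \<le> x" "x \<le> 1"
  shows "0 \<le> rate_I t x"
proof -
  have "ereal (t - x) + ereal ((1 - t) - (1 - x)) \<le> rate_I t x"
    unfolding rate_I_def by (intro add_mono entropy_term_ge) (use assms in auto)
  then show ?thesis by (simp add: zero_ereal_def)
qed

text \<open>Where \<open>t = 0\<close> or \<open>t = 1\<close>, a zero coefficient annihilates
  whatever value \<open>ln\<close> and division by 0 give, so the real formula agrees with the
  extended one.\<close>

lemma rate_I_finite:
  assumes "t = 0 \<or> x \<noteq> 0" "t = 1 \<or> x \<noteq> 1"
  shows "rate_I t x = ereal (t * ln (t / x) + (1 - t) * ln ((1 - t) / (1 - x)))"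
  using assms by (auto simp: rate_I_def entropy_term_def)

text \<open>Continuity makes superlevel sets open and sublevel sets closed, and closed subsets of
  the compact interval are compact.\<close>

lemma good_rate_function_rate_I:
  assumes "0 \<le> t" "t \<le> 1"
  shows "good_rate_function (top_of_set {0..1}) (rate_I t)"
proof -
  have op: "openin (top_of_set {0..1}) {x \<in> {0..1}. a < rate_I t x}" for a
  proof -
    have "openin (top_of_set {0..1}) ({0..1} \<inter> rate_I t -` {a<..})"
      by (rule continuous_openin_preimage_gen[OF continuous_on_rate_I]) (use assms in auto)
    then show ?thesis by (simp add: vimage_def Int_def)
  qed
  have "compactin (top_of_set {0..1}) {x \<in> {0..1}. rate_I t x \<le> a}" for a
  proof -
    have "closedin (top_of_set {0..1}) ({0..1} \<inter> rate_I t -` {..a})"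
      by (rule continuous_closedin_preimage[OF continuous_on_rate_I]) (use assms in auto)
    then have "closedin (top_of_set {0..1}) {x \<in> {0..1}. rate_I t x \<le> a}"
      by (simp add: vimage_def Int_def)
    then show ?thesis
      by (rule closedin_compact_space[rotated]) (simp add: compact_space_subtopology)
  qed
  then show ?thesis
    using op rate_I_nonneg[OF assms]
    by (auto simp: good_rate_function_def rate_function_def
             intro!: Hausdorff_space_subtopology Hausdorff_space_euclidean)
qed

section \<open>Binomial weights\<close>

text \<open>The Poisson weights \<open>k ^ j / fact j\<close> are largest at \<open>j = k\<close>,
  because the ratio \<open>k / Suc j\<close> of consecutive weights is at least 1 exactly while
  \<open>Suc j \<le> k\<close>.\<close>

lemma fact_mult_power_le: "fact k * k ^ j \<le> fact j * (k ^ k :: nat)"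
proof (cases "j \<le> k")
  case True
  then show ?thesis
  proof (induction rule: inc_induct)
    case base
    show ?case by simp
  next
    case (step j)
    \<comment> \<open>The induction descends from \<open>j = k\<close>. Here \<open>j < k\<close>,
      so \<open>Suc j \<le> k\<close>, and the positive common factor \<open>k\<close> is cancelled
      at the end.\<close>
    have "k * (fact k * k ^ j) = fact k * k ^ Suc j"
      by simp
    also have "\<dots> \<le> fact (Suc j) * k ^ k"
      by (rule step.IH)
    also have "\<dots> = Suc j * (fact j * k ^ k)"
      by (simp add: algebra_simps)
    also have "\<dots> \<le> k * (fact j * k ^ k)"
      using step.hyps by (intro mult_right_mono) auto
    finally show ?case using step.hyps by simp
  qed
next
  case False
  then have "k \<le> j" by simp
  then show ?thesis
  proof (induction rule: dec_induct)
    case base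
    show ?case by simp
  next
    case (step j)
    have "fact k * k ^ Suc j = k * (fact k * k ^ j)"
      by simp
    also have "\<dots> \<le> Suc j * (fact j * k ^ k)"
      by (rule mult_mono) (use step in auto)
    finally show ?case by (simp add: algebra_simps)
  qed
qed

text \<open>Up to the factor \<open>fact n\<close>, a binomial weight is a product of the two
  Poisson weights for \<open>j\<close> successes and \<open>n - j\<close> failures, and both are
  largest at \<open>j = k\<close>.\<close>

lemma binomial_weight_le_mode:
  assumes "k \<le> n" "j \<le> n"
  shows "(n choose j) * k ^ j * (n - k) ^ (n - j) \<le> (n choose k) * k ^ k * (n - k) ^ (n - k)"
proof -
  have "(fact k * k ^ j) * (fact (n - k) * (n - k) ^ (n - j))
      \<le> (fact j * k ^ k) * (fact (n - j) * (n - k) ^ (n - k))"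
    by (intro mult_mono fact_mult_power_le) auto
  then have "(n choose j) * (n choose k) * ((fact k * k ^ j) * (fact (n - k) * (n - k) ^ (n - j)))
      \<le> (n choose j) * (n choose k) * ((fact j * k ^ k) * (fact (n - j) * (n - k) ^ (n - k)))"
    by (rule mult_left_mono) simp
  then have "(fact k * fact (n - k) * (n choose k)) * ((n choose j) * k ^ j * (n - k) ^ (n - j))
      \<le> (fact j * fact (n - j) * (n choose j)) * ((n choose k) * k ^ k * (n - k) ^ (n - k))"
    by (simp add: algebra_simps)
  then show ?thesis
    by (simp add: binomial_fact_lemma assms)
qed

text \<open>Expanding \<open>(k + (n - k)) ^ n\<close> gives \<open>n + 1\<close> terms of which the
  \<open>k\<close>-th is the largest. This replaces Stirling's formula at the cost of a polynomial
  factor only.\<close>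

lemma power_le_mult_binomial:
  assumes "k \<le> n"
  shows "n ^ n \<le> (n + 1) * ((n choose k) * k ^ k * (n - k) ^ (n - k))"
proof -
  have "n ^ n = (k + (n - k)) ^ n"
    using assms by simp
  also have "\<dots> = (\<Sum>j\<le>n. (n choose j) * k ^ j * (n - k) ^ (n - j))"
    by (simp add: binomial)
  also have "\<dots> \<le> (\<Sum>j\<le>n. (n choose k) * k ^ k * (n - k) ^ (n - k))"
    by (intro sum_mono binomial_weight_le_mode) (use assms in auto)
  finally show ?thesis by simp
qed

text \<open>Tilting the success probability from \<open>a\<close> to \<open>t\<close>, as in the Chernoff bound. Both sides are
  kept free of denominators, so that \<open>t\<close> may be 0 or 1.\<close>

lemma sum_binomial_weight_le:
  fixes a t :: real
  assumes "k \<le> n" "J \<subseteq> {..n}" "0 \<le> a" "a \<le> 1" "0 \<le> t" "t \<le> 1"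
    and dir: "\<And>j. j \<in> J \<Longrightarrow> a \<le> t \<and> k \<le> j \<or> t \<le> a \<and> j \<le> k"
  shows "(\<Sum>j\<in>J. (n choose j) * a ^ j * (1 - a) ^ (n - j)) * (t ^ k * (1 - t) ^ (n - k))
    \<le> a ^ k * (1 - a) ^ (n - k)"
proof -
  \<comment> \<open>The likelihood ratio of \<open>a\<close> against \<open>t\<close> is monotone in
    \<open>j\<close>, so on \<open>J\<close> it is at most its value at \<open>k\<close>.
    Cross-multiplied, this rests on the comparison of \<open>a * (1 - t)\<close> with
    \<open>t * (1 - a)\<close>, which is that of \<open>a\<close> with \<open>t\<close>.\<close>
  have term_le: "(a ^ j * (1 - a) ^ (n - j)) * (t ^ k * (1 - t) ^ (n - k))
      \<le> (t ^ j * (1 - t) ^ (n - j)) * (a ^ k * (1 - a) ^ (n - k))" if j: "j \<in> J" for j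
  proof -
    have "j \<le> n" using j assms(2) by auto
    consider "a \<le> t" "k \<le> j" | "t \<le> a" "j \<le> k" using dir[OF j] by auto
    then show ?thesis
    proof cases
      case 1
      have "(a * (1 - t)) ^ (j - k) \<le> (t * (1 - a)) ^ (j - k)"
        using 1 assms by (intro power_mono mult_nonneg_nonneg) (auto simp: algebra_simps)
      then have "(a * (1 - t)) ^ (j - k) * ((a * t) ^ k * ((1 - a) * (1 - t)) ^ (n - j))
          \<le> (t * (1 - a)) ^ (j - k) * ((a * t) ^ k * ((1 - a) * (1 - t)) ^ (n - j))"
        using assms by (intro mult_right_mono) auto
      moreover have "x ^ j = x ^ (j - k) * x ^ k" "x ^ (n - k) = x ^ (j - k) * x ^ (n - j)" for x :: real
        using 1 \<open>j \<le> n\<close> by (auto simp flip: power_add)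
      ultimately show ?thesis
        by (simp add: power_mult_distrib mult_ac)
    next
      case 2
      have "(t * (1 - a)) ^ (k - j) \<le> (a * (1 - t)) ^ (k - j)"
        using 2 assms by (intro power_mono mult_nonneg_nonneg) (auto simp: algebra_simps)
      then have "(t * (1 - a)) ^ (k - j) * ((a * t) ^ j * ((1 - a) * (1 - t)) ^ (n - k))
          \<le> (a * (1 - t)) ^ (k - j) * ((a * t) ^ j * ((1 - a) * (1 - t)) ^ (n - k))"
        using assms by (intro mult_right_mono) auto
      moreover have "x ^ k = x ^ (k - j) * x ^ j" "x ^ (n - j) = x ^ (k - j) * x ^ (n - k)" for x :: real
        using 2 \<open>k \<le> n\<close> by (auto simp flip: power_add)
      ultimately show ?thesis
        by (simp add: power_mult_distrib mult_ac)
    qed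
  qed
  have "(\<Sum>j\<in>J. (n choose j) * a ^ j * (1 - a) ^ (n - j)) * (t ^ k * (1 - t) ^ (n - k))
      = (\<Sum>j\<in>J. (n choose j) * ((a ^ j * (1 - a) ^ (n - j)) * (t ^ k * (1 - t) ^ (n - k))))"
    unfolding sum_distrib_right by (intro sum.cong) (simp_all only: mult_ac)
  also have "\<dots> \<le> (\<Sum>j\<in>J. (n choose j) * ((t ^ j * (1 - t) ^ (n - j)) * (a ^ k * (1 - a) ^ (n - k))))"
    by (intro sum_mono mult_left_mono term_le) auto
  \<comment> \<open>Only now is \<open>J\<close> enlarged to all of \<open>{..n}\<close>: the
    weights for \<open>t\<close> then sum to 1.\<close>
  also have "\<dots> \<le> (\<Sum>j\<le>n. (n choose j) * ((t ^ j * (1 - t) ^ (n - j)) * (a ^ k * (1 - a) ^ (n - k))))"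
    using assms by (intro sum_mono2) auto
  also have "\<dots> = (\<Sum>j\<le>n. (n choose j) * t ^ j * (1 - t) ^ (n - j)) * (a ^ k * (1 - a) ^ (n - k))"
    unfolding sum_distrib_right by (intro sum.cong) (simp_all only: mult_ac)
  also have "(\<Sum>j\<le>n. (n choose j) * t ^ j * (1 - t) ^ (n - j)) = (t + (1 - t)) ^ n"
    by (simp only: binomial_ring)
  finally show ?thesis by simp
qed

section \<open>Order statistics\<close>

text \<open>For a downward closed \<open>P\<close> the entries satisfying it form a prefix of the
  sorted list.\<close>

lemma sorted_nth_iff_length_filter:
  fixes xs :: "'a::linorder list"
  assumes P: "\<And>u v. u \<le> v \<Longrightarrow> P v \<Longrightarrow> P u"
    and "sorted xs" "m < length xs"
  shows "P (xs ! m) \<longleftrightarrow> m < length (filter P xs)"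
  using assms(2,3)
proof (induction xs arbitrary: m)
  case Nil
  then show ?case by simp
next
  case (Cons x xs)
  show ?case
  proof (cases "P x")
    case True
    then show ?thesis using Cons by (cases m) auto
  next
    case False
    then have "\<not> P y" if "y \<in> set (x # xs)" for y
      using Cons.prems P that by auto
    then have "filter P (x # xs) = []" "\<not> P ((x # xs) ! m)"
      using nth_mem[OF Cons.prems(2)] by (auto simp only: filter_empty_conv)
    then show ?thesis by simp
  qed
qed

text \<open>Turns order statistics into counts. \<open>P\<close> is left abstract so that
  \<open>u \<le> a\<close> and \<open>u < b\<close> are both instances, one for each tail.\<close>

lemma order_statistic_iff:
  assumes P: "\<And>u v. u \<le> v \<Longrightarrow> P v \<Longrightarrow> P u" and k: "0 < k" "k \<le> n"
  shows "P (order_statistic U n k \<omega>) \<longleftrightarrow> k \<le> card {i \<in> {1..n}. P (U i \<omega>)}"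
proof -
  let ?xs = "map (\<lambda>i. U i \<omega>) [1..<Suc n]"
  have "P (order_statistic U n k \<omega>) \<longleftrightarrow> k - 1 < length (filter P (sort ?xs))"
    using k sorted_nth_iff_length_filter[of P "sort ?xs" "k - 1", OF P]
    by (simp add: order_statistic_def del: upt_Suc)
  also have "length (filter P (sort ?xs)) = length (filter P ?xs)"
    by (metis filter_sort length_sort)
  also have "\<dots> = card {i \<in> {1..n}. P (U i \<omega>)}"
  proof -
    have "length (filter P ?xs) = card ({i. P (U i \<omega>)} \<inter> set [1..<Suc n])"
      by (simp add: filter_map o_def distinct_length_filter del: upt_Suc)
    also have "{i. P (U i \<omega>)} \<inter> set [1..<Suc n] = {i \<in> {1..n}. P (U i \<omega>)}"
      by auto
    finally show ?thesis .
  qed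
  finally show ?thesis using k by auto
qed

lemma order_statistic_cases:
  assumes "k \<le> n"
  shows "order_statistic U n k \<omega> \<in> insert 0 ((\<lambda>i. U i \<omega>) ` {1..n})"
proof (cases "k = 0")
  case True
  then show ?thesis by (simp add: order_statistic_def)
next
  case False
  let ?xs = "map (\<lambda>i. U i \<omega>) [1..<Suc n]"
  have "sort ?xs ! (k - 1) \<in> set (sort ?xs)"
    using False assms by (intro nth_mem) (simp del: upt_Suc)
  then show ?thesis using False
    by (auto simp: order_statistic_def simp del: upt_Suc)
qed

section \<open>Counting events of independent variables\<close>

text \<open>Two sets are carried because the lower bound needs a gap: \<open>B = {..a}\<close> and
  \<open>C = {x<..}\<close> leave no sample point in (a, x]. The choice \<open>C = - B\<close> gives
  the plain binomial count.\<close>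

definition split_event :: "'w measure \<Rightarrow> nat set \<Rightarrow> (nat \<Rightarrow> 'w \<Rightarrow> real) \<Rightarrow> nat \<Rightarrow> real set \<Rightarrow> real set \<Rightarrow> 'w set"
  where "split_event N I X k B C =
    {\<omega> \<in> space N. \<exists>S\<subseteq>I. card S = k \<and> (\<forall>i\<in>I. X i \<omega> \<in> (if i \<in> S then B else C))}"

lemma split_event_Compl:
  assumes "finite I"
  shows "split_event N I X k B (- B) = {\<omega> \<in> space N. card {i \<in> I. X i \<omega> \<in> B} = k}"
proof -
  have "(\<exists>S\<subseteq>I. card S = k \<and> (\<forall>i\<in>I. X i \<omega> \<in> (if i \<in> S then B else - B)))
      \<longleftrightarrow> card {i \<in> I. X i \<omega> \<in> B} = k" for \<omega>
  proof
    assume "\<exists>S\<subseteq>I. card S = k \<and> (\<forall>i\<in>I. X i \<omega> \<in> (if i \<in> S then B else - B))"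
    then obtain S where S: "S \<subseteq> I" "card S = k" "\<forall>i\<in>I. X i \<omega> \<in> (if i \<in> S then B else - B)"
      by blast
    then have "{i \<in> I. X i \<omega> \<in> B} = S"
      by (auto split: if_splits)
    with S show "card {i \<in> I. X i \<omega> \<in> B} = k" by simp
  qed (auto intro!: exI[of _ "{i \<in> I. X i \<omega> \<in> B}"])
  then show ?thesis by (simp add: split_event_def)
qed

text \<open>The event is the disjoint union over the \<open>k\<close>-element index sets
  \<open>S\<close> of product events, each of probability \<open>p ^ k * q ^ (card I - k)\<close> by
  independence.\<close>

lemma (in prob_space)
  fixes p q :: real
  assumes ind: "indep_vars (\<lambda>_. borel) X I" and I: "finite I" "I \<noteq> {}"
    and BC: "B \<in> sets borel" "C \<in> sets borel" "B \<inter> C = {}"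
    and p: "\<And>i. i \<in> I \<Longrightarrow> prob (X i -` B \<inter> space M) = p"
    and q: "\<And>i. i \<in> I \<Longrightarrow> prob (X i -` C \<inter> space M) = q"
  shows split_event_sets: "split_event M I X k B C \<in> events"
    and prob_split_event: "prob (split_event M I X k B C) = (card I choose k) * p ^ k * q ^ (card I - k)"
proof -
  let ?A = "\<lambda>S i. if i \<in> S then B else C"
  define E where "E S = (\<Inter>i\<in>I. X i -` ?A S i \<inter> space M)" for S
  let ?\<S> = "{S. S \<subseteq> I \<and> card S = k}"
  have fin: "finite ?\<S>" using I by simp
  have split: "split_event M I X k B C = (\<Union>S\<in>?\<S>. E S)"
  proof (rule set_eqI)
    have "\<omega> \<in> E S \<longleftrightarrow> \<omega> \<in> space M \<and> (\<forall>i\<in>I. X i \<omega> \<in> ?A S i)" for \<omega> S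
      using I by (simp only: E_def INT_iff Int_iff vimage_eq) blast
    then show "\<omega> \<in> split_event M I X k B C \<longleftrightarrow> \<omega> \<in> (\<Union>S\<in>?\<S>. E S)" for \<omega>
      unfolding split_event_def by blast
  qed
  have rv: "X i \<in> borel_measurable M" if "i \<in> I" for i
    using ind that by (auto simp: indep_vars_def)
  have ev: "E S \<in> events" for S
    unfolding E_def using I BC rv by (intro sets.finite_INT) (auto intro!: measurable_sets)
  then show "split_event M I X k B C \<in> events"
    unfolding split using fin by (intro sets.finite_UN) auto
  have pE: "prob (E S) = p ^ k * q ^ (card I - k)" if S: "S \<in> ?\<S>" for S
  proof -
    have "prob (E S) = (\<Prod>i\<in>I. prob (X i -` ?A S i \<inter> space M))"
      unfolding E_def using BC by (intro indep_varsD_finite[OF ind] I) auto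
    also have "\<dots> = (\<Prod>i\<in>I. if i \<in> S then p else q)"
      by (intro prod.cong) (auto simp: p q)
    also have "\<dots> = (\<Prod>i\<in>I \<inter> S. p) * (\<Prod>i\<in>I \<inter> - S. q)"
      using I by (subst prod.If_cases) auto
    also have "I \<inter> S = S" using S by auto
    also have "I \<inter> - S = I - S" by auto
    finally show ?thesis
      using S I by (auto simp: card_Diff_subset finite_subset)
  qed
  have "disjoint_family_on E ?\<S>"
    unfolding disjoint_family_on_def
  proof (intro ballI impI)
    fix S S' assume S: "S \<in> ?\<S>" "S' \<in> ?\<S>" "S \<noteq> S'"
    \<comment> \<open>At an index in just one of the two sets, \<open>X i\<close> would have to lie
      in \<open>B\<close> and in \<open>C\<close> at once.\<close>
    then obtain i where i: "i \<in> I" "(i \<in> S) \<noteq> (i \<in> S')" by auto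
    then have "?A S i \<inter> ?A S' i = {}" using BC by auto
    with i show "E S \<inter> E S' = {}" unfolding E_def by blast
  qed
  then have "prob (\<Union>S\<in>?\<S>. E S) = (\<Sum>S\<in>?\<S>. prob (E S))"
    using fin ev by (intro finite_measure_finite_Union) auto
  also have "\<dots> = card ?\<S> * (p ^ k * q ^ (card I - k))"
    using pE by simp
  also have "card ?\<S> = card I choose k"
    using I by (simp add: n_subsets)
  finally show "prob (split_event M I X k B C) = (card I choose k) * p ^ k * q ^ (card I - k)"
    unfolding split by simp
qed

section \<open>Order statistics of a uniform sample\<close>

locale uniform_sample = prob_space M for M :: "'w measure" +
  fixes U :: "nat \<Rightarrow> 'w \<Rightarrow> real" and n :: nat
  assumes n_pos: "1 \<le> n"
    and indep: "indep_vars (\<lambda>_. borel) U {1..n}"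
    and distr_U: "\<And>i. i \<in> {1..n} \<Longrightarrow> distr M borel (U i) = uniform_measure lborel {0..1}"
begin

lemma measurable_U: "i \<in> {1..n} \<Longrightarrow> U i \<in> borel_measurable M"
  using indep by (auto simp: indep_vars_def)

lemma prob_U:
  assumes "i \<in> {1..n}" "B \<in> sets borel"
  shows "prob (U i -` B \<inter> space M) = measure lborel ({0..1} \<inter> B)"
proof -
  have "prob (U i -` B \<inter> space M) = measure (distr M borel (U i)) B"
    using assms measurable_U by (simp add: measure_distr)
  also have "\<dots> = measure lborel ({0..1} \<inter> B)"
    using assms by (simp add: distr_U)
  finally show ?thesis .
qed

lemma prob_U_interval:
  assumes "i \<in> {1..n}" "0 \<le> x" "x \<le> 1"
  shows "prob (U i -` {..x} \<inter> space M) = x" "prob (U i -` {..<x} \<inter> space M) = x"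
    and "prob (U i -` {x<..} \<inter> space M) = 1 - x" "prob (U i -` {x..} \<inter> space M) = 1 - x"
proof -
  have "{0..1} \<inter> {..x} = {0..x}" "{0..1} \<inter> {..<x} = {0..<x}"
    "{0..1} \<inter> {x<..} = {x<..1}" "{0..1} \<inter> {x..} = {x..1}"
    using assms by auto
  then show "prob (U i -` {..x} \<inter> space M) = x" "prob (U i -` {..<x} \<inter> space M) = x"
    "prob (U i -` {x<..} \<inter> space M) = 1 - x" "prob (U i -` {x..} \<inter> space M) = 1 - x"
    using assms by (simp_all add: prob_U)
qed

text \<open>The binomial law of the count, for an arbitrary finite set of values so that upper and
  lower tails are both covered.\<close>

lemma prob_count_in:
  fixes p :: real
  assumes B: "B \<in> sets borel" and J: "finite J"
    and p: "\<And>i. i \<in> {1..n} \<Longrightarrow> prob (U i -` B \<inter> space M) = p"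
    and q: "\<And>i. i \<in> {1..n} \<Longrightarrow> prob (U i -` (- B) \<inter> space M) = 1 - p"
  shows "{\<omega> \<in> space M. card {i \<in> {1..n}. U i \<omega> \<in> B} \<in> J} \<in> events"
    and "prob {\<omega> \<in> space M. card {i \<in> {1..n}. U i \<omega> \<in> B} \<in> J}
      = (\<Sum>j\<in>J. (n choose j) * p ^ j * (1 - p) ^ (n - j))"
proof -
  let ?E = "\<lambda>j. split_event M {1..n} U j B (- B)"
  note E = split_event_sets[OF indep _ _ B _ _ p q] prob_split_event[OF indep _ _ B _ _ p q]
  have ev: "?E j \<in> events" for j
    by (rule E) (use n_pos B in auto)
  have pr: "prob (?E j) = (n choose j) * p ^ j * (1 - p) ^ (n - j)" for j
    using E(2)[of j] n_pos B by auto
  have eq: "{\<omega> \<in> space M. card {i \<in> {1..n}. U i \<omega> \<in> B} \<in> J} = (\<Union>j\<in>J. ?E j)"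
    by (auto simp: split_event_Compl)
  show "{\<omega> \<in> space M. card {i \<in> {1..n}. U i \<omega> \<in> B} \<in> J} \<in> events"
    unfolding eq using ev J by (intro sets.finite_UN) auto
  have "disjoint_family_on ?E J"
    by (auto simp: disjoint_family_on_def split_event_Compl)
  then show "prob {\<omega> \<in> space M. card {i \<in> {1..n}. U i \<omega> \<in> B} \<in> J}
      = (\<Sum>j\<in>J. (n choose j) * p ^ j * (1 - p) ^ (n - j))"
    unfolding eq using ev J by (subst finite_measure_finite_Union) (auto simp: pr simp del: One_nat_def)
qed

lemma measurable_order_statistic [measurable]:
  assumes "k \<le> n"
  shows "order_statistic U n k \<in> borel_measurable M"
proof (cases "k = 0")
  case True
  then show ?thesis by (simp add: order_statistic_def[abs_def])
next
  case False
  have "{\<omega> \<in> space M. order_statistic U n k \<omega> \<le> y} \<in> events" for y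
  proof -
    have "{\<omega> \<in> space M. order_statistic U n k \<omega> \<le> y}
        = {\<omega> \<in> space M. k \<le> card {i \<in> {1..n}. U i \<omega> \<le> y}}"
      using False assms by (subst order_statistic_iff[where P = "\<lambda>u. u \<le> y"]) auto
    \<comment> \<open>The count becomes a sum of indicators, whose measurability is
      immediate.\<close>
    also have "\<dots> = {\<omega> \<in> space M. real k \<le> (\<Sum>i\<in>{1..n}. indicator {..y} (U i \<omega>))}"
      by (simp add: indicator_def Int_def flip: of_nat_sum)
    also have "\<dots> \<in> events"
      using measurable_U by measurable
    finally show ?thesis .
  qed
  then show ?thesis by (simp add: borel_measurable_iff_le)
qed

text \<open>Finitely many almost sure statements hold simultaneously, and an order statistic is
  either 0 or one of the sample points.\<close>

lemma AE_order_statistic: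
  assumes "k \<le> n"
  shows "AE \<omega> in M. order_statistic U n k \<omega> \<in> {0..1}"
proof -
  have "AE \<omega> in M. \<forall>i\<in>{1..n}. U i \<omega> \<in> {0..1}"
  proof (rule AE_finite_allI)
    fix i assume i: "i \<in> {1..n}"
    have "AE y in uniform_measure lborel {0..1}. y \<in> {0..1::real}"
      by (rule AE_uniform_measureI) auto
    then have "AE y in distr M borel (U i). y \<in> {0..1}"
      by (simp only: distr_U[OF i])
    then show "AE \<omega> in M. U i \<omega> \<in> {0..1}"
      by (subst (asm) AE_distr_iff) (use i measurable_U in auto)
  qed simp
  then show ?thesis
  proof eventually_elim
    case (elim \<omega>)
    then show ?case
      using order_statistic_cases[OF assms, of U \<omega>] by auto
  qed
qed

text \<open>The event is an upper tail of the binomial distribution with success probability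
  \<open>a\<close>, which is tilted upwards to \<open>t\<close>.\<close>

lemma prob_order_statistic_le:
  fixes a t :: real
  assumes k: "0 < k" "k \<le> n" and a: "0 \<le> a" "a \<le> t" "t \<le> 1"
  shows "prob {\<omega> \<in> space M. order_statistic U n k \<omega> \<le> a} * (t ^ k * (1 - t) ^ (n - k))
    \<le> a ^ k * (1 - a) ^ (n - k)"
proof -
  have "{\<omega> \<in> space M. order_statistic U n k \<omega> \<le> a}
      = {\<omega> \<in> space M. k \<le> card {i \<in> {1..n}. U i \<omega> \<le> a}}"
    using k by (subst order_statistic_iff[where P = "\<lambda>u. u \<le> a"]) auto
  also have "\<dots> = {\<omega> \<in> space M. card {i \<in> {1..n}. U i \<omega> \<in> {..a}} \<in> {k..n}}"
  proof -
    have "card {i \<in> {1..n}. U i \<omega> \<le> a} \<le> n" for \<omega>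
      by (rule order_trans[OF card_mono[of "{1..n}"]]) auto
    then show ?thesis by simp
  qed
  also have "prob \<dots> = (\<Sum>j\<in>{k..n}. (n choose j) * a ^ j * (1 - a) ^ (n - j))"
    using a by (intro prob_count_in) (auto simp: prob_U_interval)
  finally show ?thesis
    using sum_binomial_weight_le[of k n "{k..n}" a t] k a by simp
qed

text \<open>The complement of \<open>order_statistic U n k \<omega> < b\<close> is a lower tail:
  fewer than \<open>k\<close> points fall strictly below \<open>b\<close>. Here the tilt goes
  downwards to \<open>t\<close>.\<close>

lemma prob_order_statistic_ge:
  fixes b t :: real
  assumes k: "k \<le> n" and b: "0 < b" "0 \<le> t" "t \<le> b" "b \<le> 1"
  shows "prob {\<omega> \<in> space M. b \<le> order_statistic U n k \<omega>} * (t ^ k * (1 - t) ^ (n - k))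
    \<le> b ^ k * (1 - b) ^ (n - k)"
proof (cases "k = 0")
  \<comment> \<open>By convention the order statistic of index 0 is 0, hence below \<open>b\<close>,
    and the event is empty.\<close>
  case True
  then show ?thesis using b by (simp add: order_statistic_def)
next
  case False
  have "{\<omega> \<in> space M. b \<le> order_statistic U n k \<omega>}
      = {\<omega> \<in> space M. \<not> order_statistic U n k \<omega> < b}"
    by auto
  also have "\<dots> = {\<omega> \<in> space M. card {i \<in> {1..n}. U i \<omega> \<in> {..<b}} \<in> {..<k}}"
    using k False by (subst order_statistic_iff[where P = "\<lambda>u. u < b"]) auto
  also have "prob \<dots> = (\<Sum>j\<in>{..<k}. (n choose j) * b ^ j * (1 - b) ^ (n - j))"
    using b by (intro prob_count_in) (auto simp: prob_U_interval)
  finally show ?thesis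
    using sum_binomial_weight_le[of k n "{..<k}" b t] k b by (simp add: subset_iff)
qed

text \<open>If exactly \<open>k\<close> sample points are at most \<open>x\<close>, then the \<open>k\<close>-th order statistic is at most
  \<open>x\<close>, and it exceeds \<open>a\<close> unless all of these \<open>k\<close> points are at most \<open>a\<close>.\<close>

lemma prob_order_statistic_interval_ge:
  fixes a x :: real
  assumes k: "0 < k" "k \<le> n" and a: "0 \<le> a" "a \<le> x" "x \<le> 1"
  shows "(n choose k) * (x ^ k - a ^ k) * (1 - x) ^ (n - k)
    \<le> prob {\<omega> \<in> space M. order_statistic U n k \<omega> \<in> {a<..x}}"
proof -
  let ?T = "order_statistic U n k"
  let ?X = "split_event M {1..n} U k {..x} {x<..}" and ?A = "split_event M {1..n} U k {..a} {x<..}"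
  have X: "?X \<in> events" "prob ?X = (n choose k) * x ^ k * (1 - x) ^ (n - k)"
    using split_event_sets[OF indep, of "{..x}" "{x<..}" x "1 - x" k]
      prob_split_event[OF indep, of "{..x}" "{x<..}" x "1 - x" k] n_pos a
    by (auto simp: prob_U_interval disjoint_iff)
  have A: "?A \<in> events" "prob ?A = (n choose k) * a ^ k * (1 - x) ^ (n - k)"
    using split_event_sets[OF indep, of "{..a}" "{x<..}" a "1 - x" k]
      prob_split_event[OF indep, of "{..a}" "{x<..}" a "1 - x" k] n_pos a
    by (auto simp: prob_U_interval disjoint_iff)
  have "?X - ?A \<subseteq> {\<omega> \<in> space M. ?T \<omega> \<in> {a<..x}}"
  proof
    fix \<omega> assume \<omega>: "\<omega> \<in> ?X - ?A"
    then obtain S where S: "S \<subseteq> {1..n}" "card S = k"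
        "\<forall>i\<in>{1..n}. U i \<omega> \<in> (if i \<in> S then {..x} else {x<..})"
      by (auto simp: split_event_def)
    have eq: "{i \<in> {1..n}. U i \<omega> \<le> x} = S"
      using S by (force split: if_splits)
    then have le: "?T \<omega> \<le> x"
      using S k by (subst order_statistic_iff[where P = "\<lambda>u. u \<le> x"]) auto
    have "a < ?T \<omega>"
    proof (rule ccontr)
      assume "\<not> a < ?T \<omega>"
      then have "?T \<omega> \<le> a" by simp
      then have "k \<le> card {i \<in> {1..n}. U i \<omega> \<le> a}"
        using k by (subst (asm) order_statistic_iff[where P = "\<lambda>u. u \<le> a"]) auto
      moreover have sub: "{i \<in> {1..n}. U i \<omega> \<le> a} \<subseteq> S"
        using a by (auto simp flip: eq)
      moreover have "finite S"
        using S finite_subset by blast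
      \<comment> \<open>At least \<open>k\<close> points at most \<open>a\<close>, all with index in
        a set of size \<open>k\<close>, exhaust that set; this is the excluded event
        \<open>?A\<close>.\<close>
      ultimately have "{i \<in> {1..n}. U i \<omega> \<le> a} = S"
        using S by (intro card_seteq) auto
      then have "\<forall>i\<in>{1..n}. U i \<omega> \<in> (if i \<in> S then {..a} else {x<..})"
        using S by (auto split: if_splits)
      with S \<omega> show False
        unfolding split_event_def by blast
    qed
    with le \<omega> show "\<omega> \<in> {\<omega> \<in> space M. ?T \<omega> \<in> {a<..x}}"
      by (simp add: split_event_def)
  qed
  moreover have "{\<omega> \<in> space M. ?T \<omega> \<in> {a<..x}} \<in> events"
    using k by measurable
  ultimately have "prob (?X - ?A) \<le> prob {\<omega> \<in> space M. ?T \<omega> \<in> {a<..x}}"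
    by (intro finite_measure_mono) auto
  moreover have "?A \<subseteq> ?X"
  proof -
    have "u \<in> (if P then {..a} else {x<..}) \<Longrightarrow> u \<in> (if P then {..x} else {x<..})" for u P
      using a by (auto split: if_splits)
    then show ?thesis
      unfolding split_event_def by blast
  qed
  then have "prob (?X - ?A) = prob ?X - prob ?A"
    using X A by (intro finite_measure_Diff) auto
  ultimately show ?thesis
    using X(2) A(2) by (simp add: algebra_simps del: One_nat_def)
qed

end

section \<open>Asymptotics\<close>

lemma nat_floor_mult_le:
  assumes "t \<le> 1"
  shows "nat \<lfloor>real n * t\<rfloor> \<le> n"
proof -
  have "real n * t \<le> real n"
    using assms by (simp add: mult_left_le)
  then show ?thesis by linarith
qed

lemma nat_floor_mult_div_tendsto:
  assumes "0 \<le> t"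
  shows "(\<lambda>n. real (nat \<lfloor>real n * t\<rfloor>) / real n) \<longlonglongrightarrow> t"
proof (rule tendsto_sandwich)
  have "t - 1 / real n \<le> real (nat \<lfloor>real n * t\<rfloor>) / real n \<and> real (nat \<lfloor>real n * t\<rfloor>) / real n \<le> t"
    if n: "n \<ge> 1" for n
  proof -
    have "real n * t - 1 \<le> real (nat \<lfloor>real n * t\<rfloor>)" "real (nat \<lfloor>real n * t\<rfloor>) \<le> real n * t"
      using assms by simp_all
    then have "(real n * t - 1) / real n \<le> real (nat \<lfloor>real n * t\<rfloor>) / real n"
      "real (nat \<lfloor>real n * t\<rfloor>) / real n \<le> real n * t / real n"
      by (simp_all only: divide_right_mono of_nat_0_le_iff)
    then show ?thesis using n by (simp add: diff_divide_distrib)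
  qed
  then show "\<forall>\<^sub>F n in sequentially. t - 1 / real n \<le> real (nat \<lfloor>real n * t\<rfloor>) / real n"
    and "\<forall>\<^sub>F n in sequentially. real (nat \<lfloor>real n * t\<rfloor>) / real n \<le> t"
    by (auto simp: eventually_sequentially)
  show "(\<lambda>n. t - 1 / real n) \<longlonglongrightarrow> t"
    by real_asymp
qed simp

lemma nat_floor_mult_compl_div_tendsto:
  assumes "0 \<le> t" "t \<le> 1"
  shows "(\<lambda>n. real (n - nat \<lfloor>real n * t\<rfloor>) / real n) \<longlonglongrightarrow> 1 - t"
proof -
  have "(\<lambda>n. 1 - real (nat \<lfloor>real n * t\<rfloor>) / real n) \<longlonglongrightarrow> 1 - t"
    by (intro tendsto_intros nat_floor_mult_div_tendsto assms)
  moreover have "\<forall>\<^sub>F n in sequentially. 1 - real (nat \<lfloor>real n * t\<rfloor>) / real n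
      = real (n - nat \<lfloor>real n * t\<rfloor>) / real n"
    using eventually_gt_at_top[of 0]
    by eventually_elim (simp add: of_nat_diff[OF nat_floor_mult_le[OF assms(2)]] diff_divide_distrib)
  ultimately show ?thesis by (rule Lim_transform_eventually)
qed

lemma eventually_nat_floor_mult_pos:
  assumes "0 < t"
  shows "\<forall>\<^sub>F n in sequentially. 0 < nat \<lfloor>real n * t\<rfloor>"
proof -
  have "\<forall>\<^sub>F n in sequentially. 0 < real (nat \<lfloor>real n * t\<rfloor>) / real n"
    using order_tendstoD(1)[OF nat_floor_mult_div_tendsto] assms by auto
  then show ?thesis
    by eventually_elim (auto simp: zero_less_divide_iff simp del: zero_less_nat_eq)
qed

lemma eventually_nat_floor_mult_less:
  assumes "0 \<le> t" "t < 1"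
  shows "\<forall>\<^sub>F n in sequentially. nat \<lfloor>real n * t\<rfloor> < n"
proof -
  have "\<forall>\<^sub>F n in sequentially. 0 < real (n - nat \<lfloor>real n * t\<rfloor>) / real n"
    using order_tendstoD(1)[OF nat_floor_mult_compl_div_tendsto] assms by auto
  then show ?thesis
    by eventually_elim (auto simp: zero_less_divide_iff)
qed

section \<open>Exponential order of binomial weights\<close>

lemma exp_of_nat_mult_ln:
  fixes y :: real
  assumes "m = 0 \<or> 0 < y"
  shows "exp (real m * ln y) = y ^ m"
  using assms by (auto simp: exp_of_nat_mult)

text \<open>The quotient of the two weights is exp(-n r) with r tending to
  \<open>rate_I t a\<close>, so r eventually exceeds \<open>c\<close>. This turns the tilting bound
  into an exponential rate.\<close>

lemma eventually_power_le_exp: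
  assumes t: "0 \<le> t" "t \<le> 1" and a: "0 \<le> a" "a \<le> 1" and c: "ereal c < rate_I t a"
  defines "k \<equiv> \<lambda>n. nat \<lfloor>real n * t\<rfloor>"
  shows "\<forall>\<^sub>F n in sequentially.
    a ^ k n * (1 - a) ^ (n - k n) \<le> exp (- (c * real n)) * (t ^ k n * (1 - t) ^ (n - k n))"
proof -
  \<comment> \<open>In the first two cases the rate is infinite, and the left side is eventually 0
    because its vanishing base has a positive exponent.\<close>
  consider "0 < t" "a = 0" | "t < 1" "a = 1" | "t = 0 \<or> a \<noteq> 0" "t = 1 \<or> a \<noteq> 1"
    using t by force
  then show ?thesis
  proof cases
    case 1
    from eventually_nat_floor_mult_pos[OF 1(1)] show ?thesis
      by eventually_elim (use t 1 in \<open>simp add: k_def zero_power\<close>)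
  next
    case 2
    from eventually_nat_floor_mult_less[OF t(1) 2(1)] show ?thesis
      by eventually_elim (use t 2 in \<open>simp add: k_def zero_power\<close>)
  next
    case 3
    let ?u = "\<lambda>n. real (k n) / real n" and ?v = "\<lambda>n. real (n - k n) / real n"
    let ?r = "\<lambda>n. ?u n * ln (t / a) + ?v n * ln ((1 - t) / (1 - a))"
    have "?r \<longlonglongrightarrow> t * ln (t / a) + (1 - t) * ln ((1 - t) / (1 - a))"
      unfolding k_def
      by (intro tendsto_intros nat_floor_mult_div_tendsto nat_floor_mult_compl_div_tendsto t)
    then have "\<forall>\<^sub>F n in sequentially. c < ?r n"
      using c by (intro order_tendstoD(1)) (auto simp: rate_I_finite[OF 3])
    then show ?thesis
      using eventually_gt_at_top[of 0]
    proof eventually_elim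
      case (elim n)
      \<comment> \<open>At the ends of the range of \<open>t\<close> a base such as
        \<open>t / a\<close> may be 0, but then its exponent is 0 as well.\<close>
      have t0: "k n = 0" if "t = 0" using that by (simp add: k_def)
      have t1: "n - k n = 0" if "t = 1" using that by (simp add: k_def)
      have pos: "k n = 0 \<or> 0 < t / a" "n - k n = 0 \<or> 0 < (1 - t) / (1 - a)"
      proof -
        have "0 < t / a" if "t \<noteq> 0"
          using that 3(1) t a by (intro divide_pos_pos) auto
        then show "k n = 0 \<or> 0 < t / a" using t0 by blast
        have "0 < (1 - t) / (1 - a)" if "t \<noteq> 1"
          using that 3(2) t a by (intro divide_pos_pos) auto
        then show "n - k n = 0 \<or> 0 < (1 - t) / (1 - a)" using t1 by blast
      qed
      have "c * real n \<le> ?r n * real n"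
        using elim by simp
      also have "\<dots> = real (k n) * ln (t / a) + real (n - k n) * ln ((1 - t) / (1 - a))"
        using elim by (simp add: field_simps)
      finally have "exp (c * real n) \<le> exp (real (k n) * ln (t / a)) * exp (real (n - k n) * ln ((1 - t) / (1 - a)))"
        by (simp flip: exp_add)
      also have "\<dots> = (t / a) ^ k n * ((1 - t) / (1 - a)) ^ (n - k n)"
        using pos by (simp only: exp_of_nat_mult_ln)
      finally have "(a ^ k n * (1 - a) ^ (n - k n)) * exp (c * real n)
          \<le> (a ^ k n * (1 - a) ^ (n - k n)) * ((t / a) ^ k n * ((1 - t) / (1 - a)) ^ (n - k n))"
        using a by (intro mult_left_mono) auto
      also have "\<dots> = (a ^ k n * (t / a) ^ k n) * ((1 - a) ^ (n - k n) * ((1 - t) / (1 - a)) ^ (n - k n))"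
        by (simp only: mult_ac)
      also have "a ^ k n * (t / a) ^ k n = t ^ k n"
        using pos by (auto simp flip: power_mult_distrib)
      also have "(1 - a) ^ (n - k n) * ((1 - t) / (1 - a)) ^ (n - k n) = (1 - t) ^ (n - k n)"
        using pos(2) by (cases "n - k n = 0") (auto simp flip: power_mult_distrib)
      finally show ?case
        by (simp add: exp_minus field_simps)
    qed
  qed
qed

text \<open>Permits cancelling the weight for \<open>t\<close> in the tilting bound. For
  \<open>t = 0\<close> and \<open>t = 1\<close> the vanishing base has exponent 0.\<close>

lemma power_nat_floor_pos:
  fixes t :: real
  assumes "0 \<le> t" "t \<le> 1"
  shows "0 < t ^ nat \<lfloor>real n * t\<rfloor> * (1 - t) ^ (n - nat \<lfloor>real n * t\<rfloor>)"
proof -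
  consider "t = 0" | "t = 1" | "0 < t" "t < 1" using assms by force
  then show ?thesis by cases auto
qed

text \<open>The exponent is -n times the rate with \<open>k / n\<close> in place of
  \<open>t\<close>. The binomial coefficient loses only the factor \<open>n + 1\<close>, and
  removing \<open>a ^ k\<close> loses only the factor \<open>1 - a / x\<close>.\<close>

lemma binomial_mult_power_diff_ge:
  fixes a x :: real
  assumes k: "0 < k" "k \<le> n" and a: "0 \<le> a" "a < x" "x \<le> 1" and x1: "x < 1 \<or> k = n"
  shows "(1 - a / x) / real (n + 1) * exp (real k * ln (x / (real k / real n))
      + real (n - k) * ln ((1 - x) / (real (n - k) / real n)))
    \<le> (n choose k) * (x ^ k - a ^ k) * (1 - x) ^ (n - k)"
proof -
  define m where "m = n - k"
  have n: "n = k + m" "0 < n" using k by (auto simp: m_def)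
  have "exp (real k * ln (x / (real k / real n)) + real m * ln ((1 - x) / (real m / real n)))
      = (x / (real k / real n)) ^ k * ((1 - x) / (real m / real n)) ^ m"
    unfolding exp_add
  proof (intro arg_cong2[where f = "(*)"] exp_of_nat_mult_ln)
    show "k = 0 \<or> 0 < x / (real k / real n)" using k a n by auto
    show "m = 0 \<or> 0 < (1 - x) / (real m / real n)" using x1 n k
      by (cases "m = 0") (auto intro!: divide_pos_pos mult_pos_pos)
  qed
  also have "\<dots> = x ^ k * (1 - x) ^ m * (real n ^ n / (real k ^ k * real m ^ m))"
  proof -
    have "real n ^ n = real n ^ k * real n ^ m"
      unfolding n(1) by (rule power_add)
    then show ?thesis
      by (simp add: power_divide power_mult_distrib)
  qed
  finally have E: "exp (real k * ln (x / (real k / real n)) + real m * ln ((1 - x) / (real m / real n)))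
      = x ^ k * (1 - x) ^ m * (real n ^ n / (real k ^ k * real m ^ m))" .
  have "real (n ^ n) \<le> real ((n + 1) * ((n choose k) * k ^ k * m ^ m))"
    unfolding m_def of_nat_le_iff by (rule power_le_mult_binomial) (use k in auto)
  then have "real n ^ n \<le> real (n choose k) * (real k ^ k * real m ^ m * real (n + 1))"
    by (simp only: of_nat_mult of_nat_power mult_ac)
  moreover have "0 < real k ^ k * real m ^ m"
    using k by (cases "m = 0") auto
  ultimately have C: "real n ^ n / (real k ^ k * real m ^ m) / real (n + 1) \<le> real (n choose k)"
    unfolding divide_divide_eq_left by (subst pos_divide_le_eq) auto
  \<comment> \<open>Since \<open>k\<close> is at least 1, this makes the loss uniform in
    \<open>k\<close>.\<close>
  have "(a / x) ^ k \<le> (a / x) ^ 1"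
    by (rule power_decreasing) (use k a in auto)
  then have "x ^ k * (1 - a / x) \<le> x ^ k * (1 - (a / x) ^ k)"
    using a by (intro mult_left_mono) auto
  also have "\<dots> = x ^ k - a ^ k"
    using a by (simp add: field_simps power_divide)
  finally have D: "x ^ k * (1 - a / x) \<le> x ^ k - a ^ k" .
  have "(1 - a / x) / real (n + 1) * (x ^ k * (1 - x) ^ m * (real n ^ n / (real k ^ k * real m ^ m)))
      = (real n ^ n / (real k ^ k * real m ^ m) / real (n + 1)) * (x ^ k * (1 - a / x)) * (1 - x) ^ m"
    by (simp only: divide_divide_eq_left times_divide_eq_left times_divide_eq_right mult_ac)
  also have "\<dots> \<le> (n choose k) * (x ^ k - a ^ k) * (1 - x) ^ m"
    using a by (intro mult_right_mono mult_mono C D) auto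
  finally show ?thesis
    unfolding E m_def[symmetric] .
qed

lemma log_prob_rate_ge:
  assumes "n \<ge> 1" and p: "0 < p" "p \<le> measure (M n) {\<omega> \<in> space (M n). Y n \<omega> \<in> A}"
  shows "ereal (ln p / real n) \<le> log_prob_rate M Y A n"
  using assms by (auto simp: log_prob_rate_def elog_def divide_right_mono)

lemma log_prob_rate_le:
  assumes "n \<ge> 1" and p: "0 < p" "measure (M n) {\<omega> \<in> space (M n). Y n \<omega> \<in> A} \<le> p"
  shows "log_prob_rate M Y A n \<le> ereal (ln p / real n)"
proof (cases "measure (M n) {\<omega> \<in> space (M n). Y n \<omega> \<in> A} = 0")
  case True
  then show ?thesis using assms by (simp add: log_prob_rate_def elog_def)
next
  case False
  then have "0 < measure (M n) {\<omega> \<in> space (M n). Y n \<omega> \<in> A}"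
    by (simp add: zero_less_measure_iff)
  then show ?thesis using assms by (auto simp: log_prob_rate_def elog_def divide_right_mono)
qed

section \<open>The large deviations bounds\<close>

locale uniform_quantiles =
  fixes t :: real and M :: "nat \<Rightarrow> 'w measure"
    and U :: "nat \<Rightarrow> nat \<Rightarrow> 'w \<Rightarrow> real" and T :: "nat \<Rightarrow> 'w \<Rightarrow> real"
  assumes t: "0 \<le> t" "t \<le> 1"
    and sample: "\<And>n. n \<ge> 1 \<Longrightarrow> uniform_sample (M n) (U n) n"
    and T: "\<And>n. n \<ge> 1 \<Longrightarrow> T n = order_statistic (U n) n (nat \<lfloor>real n * t\<rfloor>)"
begin

lemma measurable_T: "n \<ge> 1 \<Longrightarrow> T n \<in> borel_measurable (M n)"
  using uniform_sample.measurable_order_statistic[OF sample] nat_floor_mult_le[OF t(2)] by (simp add: T)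

lemma prob_space_M: "n \<ge> 1 \<Longrightarrow> prob_space (M n)"
  using sample by (simp add: uniform_sample_def)

lemma sets_T_in:
  assumes "n \<ge> 1" "A \<in> sets borel"
  shows "{\<omega> \<in> space (M n). T n \<omega> \<in> A} \<in> sets (M n)"
  using measurable_sets[OF measurable_T[OF assms(1)] assms(2)]
  by (simp add: vimage_def Int_def conj_commute)

lemma random_element_T:
  assumes "n \<ge> 1"
  shows "random_element (top_of_set {0..1}) (M n) (T n)"
proof -
  have "G \<in> sets borel" if "openin (top_of_set {0..1}) G" for G :: "real set"
    using that by (auto simp: openin_open)
  moreover have "AE \<omega> in M n. T n \<omega> \<in> {0..1}"
    using uniform_sample.AE_order_statistic[OF sample[OF assms] nat_floor_mult_le[OF t(2)]] assms
    by (simp add: T)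
  ultimately show ?thesis
    using assms by (simp add: random_element_def prob_space_M sets_T_in)
qed

section \<open>Upper bound: tails, then closed sets\<close>

lemma eventually_prob_T_le:
  assumes "0 \<le> a" "a < t" "ereal c < rate_I t a"
  shows "\<forall>\<^sub>F n in sequentially. measure (M n) {\<omega> \<in> space (M n). T n \<omega> \<le> a} \<le> exp (- (c * real n))"
proof -
  have "0 < t" "a \<le> 1" using assms t by auto
  show ?thesis
    using eventually_power_le_exp[OF t assms(1) \<open>a \<le> 1\<close> assms(3)]
      eventually_nat_floor_mult_pos[OF \<open>0 < t\<close>] eventually_ge_at_top[of 1]
  proof eventually_elim
    case (elim n)
    then interpret uniform_sample "M n" "U n" n
      using sample by simp
    let ?w = "t ^ nat \<lfloor>real n * t\<rfloor> * (1 - t) ^ (n - nat \<lfloor>real n * t\<rfloor>)"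
    have "prob {\<omega> \<in> space (M n). T n \<omega> \<le> a} * ?w \<le> exp (- (c * real n)) * ?w"
      unfolding T[OF elim(3)]
      by (rule order_trans[OF prob_order_statistic_le elim(1)])
        (use elim nat_floor_mult_le[OF t(2)] t assms in auto)
    then show ?case
      by (rule mult_right_le_imp_le) (rule power_nat_floor_pos[OF t])
  qed
qed

lemma eventually_prob_T_ge:
  assumes "t < b" "b \<le> 1" "ereal c < rate_I t b"
  shows "\<forall>\<^sub>F n in sequentially. measure (M n) {\<omega> \<in> space (M n). b \<le> T n \<omega>} \<le> exp (- (c * real n))"
proof -
  have "0 < b" using assms t by auto
  show ?thesis
    using eventually_power_le_exp[OF t less_imp_le[OF \<open>0 < b\<close>] assms(2,3)] eventually_ge_at_top[of 1]
  proof eventually_elim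
    case (elim n)
    then interpret uniform_sample "M n" "U n" n
      using sample by simp
    let ?w = "t ^ nat \<lfloor>real n * t\<rfloor> * (1 - t) ^ (n - nat \<lfloor>real n * t\<rfloor>)"
    have "prob {\<omega> \<in> space (M n). b \<le> T n \<omega>} * ?w \<le> exp (- (c * real n)) * ?w"
      unfolding T[OF elim(2)]
      by (rule order_trans[OF prob_order_statistic_ge elim(1)])
        (use elim nat_floor_mult_le[OF t(2)] t assms in auto)
    then show ?case
      by (rule mult_right_le_imp_le) (rule power_nat_floor_pos[OF t])
  qed
qed

text \<open>By compactness the points of \<open>F\<close> nearest to \<open>t\<close> on either side
  belong to \<open>F\<close>, so the assumption on \<open>c\<close> applies at the ends of both
  tails. The factor 2 counts the tails.\<close>

lemma eventually_prob_T_in_closed_le: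
  assumes F: "compact F" "F \<subseteq> {0..1}" and c: "\<And>x. x \<in> F \<Longrightarrow> ereal c < rate_I t x"
  shows "\<forall>\<^sub>F n in sequentially. measure (M n) {\<omega> \<in> space (M n). T n \<omega> \<in> F} \<le> 2 * exp (- (c * real n))"
proof (cases "t \<in> F")
  case True
  \<comment> \<open>The rate vanishes at \<open>t\<close>, so \<open>c\<close> is negative and the
    claimed bound exceeds 1.\<close>
  from c[OF this] have "c < 0"
    using t by (auto simp: rate_I_def entropy_term_def split: if_splits)
  show ?thesis
    using eventually_ge_at_top[of 1]
  proof eventually_elim
    case (elim n)
    have "measure (M n) {\<omega> \<in> space (M n). T n \<omega> \<in> F} \<le> 1"
      using prob_space.prob_le_1[OF prob_space_M[OF elim]] .
    also have "1 \<le> exp (- (c * real n))"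
      using \<open>c < 0\<close> by (simp add: mult_nonpos_nonneg)
    finally show ?case
      using exp_gt_zero[of "- (c * real n)"] by linarith
  qed
next
  case False
  have left: "\<forall>\<^sub>F n in sequentially.
    measure (M n) {\<omega> \<in> space (M n). T n \<omega> \<in> F \<inter> {..t}} \<le> exp (- (c * real n))"
  proof (cases "F \<inter> {..t} = {}")
    case True
    then show ?thesis by simp
  next
    case False
    have "compact (F \<inter> {..t})"
      using F by (simp add: compact_Int_closed)
    from compact_attains_sup[OF this False]
    obtain a where a: "a \<in> F" "a \<le> t" "\<And>x. x \<in> F \<inter> {..t} \<Longrightarrow> x \<le> a"
      by auto
    have "\<forall>\<^sub>F n in sequentially. measure (M n) {\<omega> \<in> space (M n). T n \<omega> \<le> a} \<le> exp (- (c * real n))"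
      \<comment> \<open>Since \<open>t\<close> is not in \<open>F\<close>, the endpoint
        \<open>a\<close> lies strictly left of \<open>t\<close>.\<close>
      by (rule eventually_prob_T_le) (use a F c \<open>t \<notin> F\<close> in \<open>auto simp: less_le\<close>)
    then show ?thesis
      using eventually_ge_at_top[of 1]
    proof eventually_elim
      case (elim n)
      interpret prob_space "M n" by (rule prob_space_M) fact
      have "prob {\<omega> \<in> space (M n). T n \<omega> \<in> F \<inter> {..t}} \<le> prob {\<omega> \<in> space (M n). T n \<omega> \<le> a}"
        using a sets_T_in[OF elim(2), of "{..a}"] by (intro finite_measure_mono) auto
      then show ?case using elim(1) by linarith
    qed
  qed
  have right: "\<forall>\<^sub>F n in sequentially.
    measure (M n) {\<omega> \<in> space (M n). T n \<omega> \<in> F \<inter> {t..}} \<le> exp (- (c * real n))"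
  proof (cases "F \<inter> {t..} = {}")
    case True
    then show ?thesis by simp
  next
    case False
    have "compact (F \<inter> {t..})"
      using F by (simp add: compact_Int_closed)
    from compact_attains_inf[OF this False]
    obtain b where b: "b \<in> F" "t \<le> b" "\<And>x. x \<in> F \<inter> {t..} \<Longrightarrow> b \<le> x"
      by auto
    have "\<forall>\<^sub>F n in sequentially. measure (M n) {\<omega> \<in> space (M n). b \<le> T n \<omega>} \<le> exp (- (c * real n))"
      by (rule eventually_prob_T_ge) (use b F c \<open>t \<notin> F\<close> in \<open>auto simp: less_le\<close>)
    then show ?thesis
      using eventually_ge_at_top[of 1]
    proof eventually_elim
      case (elim n)
      interpret prob_space "M n" by (rule prob_space_M) fact
      have "prob {\<omega> \<in> space (M n). T n \<omega> \<in> F \<inter> {t..}} \<le> prob {\<omega> \<in> space (M n). b \<le> T n \<omega>}"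
        using b sets_T_in[OF elim(2), of "{b..}"] by (intro finite_measure_mono) auto
      then show ?case using elim(1) by linarith
    qed
  qed
  from left right show ?thesis
    using eventually_ge_at_top[of 1]
  proof eventually_elim
    case (elim n)
    interpret prob_space "M n" by (rule prob_space_M) fact
    have "F \<in> sets borel" using F by (simp add: borel_compact)
    have "{\<omega> \<in> space (M n). T n \<omega> \<in> F}
        = {\<omega> \<in> space (M n). T n \<omega> \<in> F \<inter> {..t}} \<union> {\<omega> \<in> space (M n). T n \<omega> \<in> F \<inter> {t..}}"
      by auto
    also have "prob \<dots> \<le> prob {\<omega> \<in> space (M n). T n \<omega> \<in> F \<inter> {..t}}
        + prob {\<omega> \<in> space (M n). T n \<omega> \<in> F \<inter> {t..}}"
      by (intro measure_Un_le sets_T_in elim(3)) (use \<open>F \<in> sets borel\<close> in auto)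
    finally show ?case using elim(1,2) by linarith
  qed
qed

lemma LDP_upper_bound_T: "LDP_upper_bound (top_of_set {0..1}) M T (rate_I t)"
  unfolding LDP_upper_bound_def
proof (intro allI impI)
  fix F :: "real set" assume "closedin (top_of_set {0..1}) F"
  then have F: "compact F" "F \<subseteq> {0..1}"
    using closedin_compact[OF compact_Icc] closedin_imp_subset by blast+
  let ?L = "limsup (log_prob_rate M T F)"
  show "?L \<le> - (INF x\<in>F. rate_I t x)"
  proof (rule ccontr)
    assume "\<not> ?L \<le> - (INF x\<in>F. rate_I t x)"
    then have "- (INF x\<in>F. rate_I t x) < ?L"
      by (simp only: not_le)
    \<comment> \<open>A real \<open>z\<close> strictly in between handles infinite values of the
      infimum uniformly; \<open>- z\<close> then lies strictly below the rate on all of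
      \<open>F\<close> and serves as \<open>c\<close>.\<close>
    from ereal_dense2[OF this]
    obtain z where z: "- (INF x\<in>F. rate_I t x) < ereal z" "ereal z < ?L"
      by blast
    have "ereal (- z) < (INF x\<in>F. rate_I t x)"
      using z(1) by (subst (asm) ereal_uminus_less_reorder) (simp only: uminus_ereal.simps)
    then have "ereal (- z) < rate_I t x" if "x \<in> F" for x
      using that by (rule less_INF_D)
    then have "\<forall>\<^sub>F n in sequentially.
        measure (M n) {\<omega> \<in> space (M n). T n \<omega> \<in> F} \<le> 2 * exp (- (- z * real n))"
      by (rule eventually_prob_T_in_closed_le[OF F])
    then have "\<forall>\<^sub>F n in sequentially. log_prob_rate M T F n \<le> ereal (ln 2 / real n + z)"
      using eventually_ge_at_top[of 1]
    proof eventually_elim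
      case (elim n)
      have "log_prob_rate M T F n \<le> ereal (ln (2 * exp (z * real n)) / real n)"
        by (rule log_prob_rate_le) (use elim in auto)
      also have "ln (2 * exp (z * real n)) / real n = ln 2 / real n + z"
        using elim by (simp add: ln_mult field_simps)
      finally show ?case .
    qed
    then have "?L \<le> limsup (\<lambda>n. ereal (ln 2 / real n + z))"
      by (rule Limsup_mono)
    also have "(\<lambda>n. ln 2 / real n + z) \<longlonglongrightarrow> z"
      by real_asymp
    then have "limsup (\<lambda>n. ereal (ln 2 / real n + z)) = ereal z"
      by (intro lim_imp_Limsup) auto
    finally show False using z(2) by simp
  qed
qed

section \<open>Lower bound: half-open intervals, then open sets\<close>

text \<open>The finite bound for (a, x] has a prefactor that disappears after taking logarithms and
  dividing by \<open>n\<close>. What remains is minus the rate with [nt]/n in place of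
  \<open>t\<close>, which converges to \<open>- rate_I t x\<close>.\<close>

lemma liminf_log_prob_rate_interval_ge:
  assumes t0: "0 < t" and a: "0 \<le> a" "a < x" "x \<le> 1" "t = 1 \<or> x \<noteq> 1"
    and sub: "{a<..x} \<subseteq> G" and G: "G \<in> sets borel"
  shows "- rate_I t x \<le> liminf (log_prob_rate M T G)"
proof -
  define k where "k n = nat \<lfloor>real n * t\<rfloor>" for n :: nat
  let ?u = "\<lambda>n. real (k n) / real n" and ?v = "\<lambda>n. real (n - k n) / real n"
  \<comment> \<open>\<open>?r n\<close> is the logarithm of the lower bound in
    \<open>binomial_mult_power_diff_ge\<close>, divided by \<open>n\<close>.\<close>
  let ?r = "\<lambda>n. (ln (1 - a / x) - ln (real (n + 1))) / real n
    + (?u n * ln (x / ?u n) + ?v n * ln ((1 - x) / ?v n))"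
  have u: "?u \<longlonglongrightarrow> t" and v: "?v \<longlonglongrightarrow> 1 - t"
    unfolding k_def by (intro nat_floor_mult_div_tendsto nat_floor_mult_compl_div_tendsto t)+
  have "(\<lambda>n. (ln (1 - a / x) - ln (real (n + 1))) / real n) \<longlonglongrightarrow> 0"
    by real_asymp
  moreover have "(\<lambda>n. ?u n * ln (x / ?u n)) \<longlonglongrightarrow> t * ln (x / t)"
    using t0 a by (intro tendsto_intros u) auto
  moreover have "(\<lambda>n. ?v n * ln ((1 - x) / ?v n)) \<longlonglongrightarrow> (1 - t) * ln ((1 - x) / (1 - t))"
  proof (cases "t = 1")
    case True
    \<comment> \<open>For \<open>t = 1\<close> the proportion \<open>?v n\<close> is identically 0,
      so the quotient by it does not matter.\<close>
    then show ?thesis by (simp add: k_def)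
  next
    case False
    then show ?thesis using t a by (intro tendsto_intros v) auto
  qed
  ultimately have "?r \<longlonglongrightarrow> 0 + (t * ln (x / t) + (1 - t) * ln ((1 - x) / (1 - t)))"
    by (intro tendsto_add)
  also have "0 + (t * ln (x / t) + (1 - t) * ln ((1 - x) / (1 - t)))
      = - (t * ln (t / x) + (1 - t) * ln ((1 - t) / (1 - x)))"
    using t0 t a by (auto simp: ln_div algebra_simps)
  finally have "(\<lambda>n. ereal (?r n)) \<longlonglongrightarrow> - rate_I t x"
    using a by (subst rate_I_finite) (auto simp del: of_nat_add)
  then have "- rate_I t x = liminf (\<lambda>n. ereal (?r n))"
    by (intro lim_imp_Liminf[symmetric]) auto
  also have "\<dots> \<le> liminf (log_prob_rate M T G)"
  proof (rule Liminf_mono)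
    show "\<forall>\<^sub>F n in sequentially. ereal (?r n) \<le> log_prob_rate M T G n"
      using eventually_nat_floor_mult_pos[OF t0] eventually_ge_at_top[of 1]
    proof eventually_elim
      case (elim n)
      interpret uniform_sample "M n" "U n" n
        using sample elim by simp
      let ?e = "real (k n) * ln (x / ?u n) + real (n - k n) * ln ((1 - x) / ?v n)"
      let ?p = "(1 - a / x) / real (n + 1) * exp ?e"
      have k: "0 < k n" "k n \<le> n"
        using elim nat_floor_mult_le[OF t(2)] by (simp_all add: k_def)
      have x1: "x < 1 \<or> k n = n"
        using a by (auto simp: k_def)
      have ax: "0 < 1 - a / x"
        using a by simp
      have "?p \<le> (n choose k n) * (x ^ k n - a ^ k n) * (1 - x) ^ (n - k n)"
        by (rule binomial_mult_power_diff_ge[OF k a(1-3) x1])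
      also have "\<dots> \<le> prob {\<omega> \<in> space (M n). T n \<omega> \<in> {a<..x}}"
        using prob_order_statistic_interval_ge[OF k a(1) less_imp_le[OF a(2)] a(3)] elim
        by (simp add: T k_def)
      also have "\<dots> \<le> prob {\<omega> \<in> space (M n). T n \<omega> \<in> G}"
        using sub by (intro finite_measure_mono sets_T_in elim G) auto
      finally have "ereal (ln ?p / real n) \<le> log_prob_rate M T G n"
        using ax elim by (intro log_prob_rate_ge) auto
      also have "ln ?p = ln (1 - a / x) - ln (real (n + 1)) + ?e"
      proof -
        have "ln (d / y * exp e) = ln d - ln y + e" if "0 < d" "0 < y" for d y e :: real
          using that by (simp add: ln_mult ln_div)
        from this[OF ax] show ?thesis by simp
      qed
      also have "\<dots> / real n = ?r n"
        by (simp only: add_divide_distrib times_divide_eq_left)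
      finally show ?case .
    qed
  qed
  finally show ?thesis .
qed

text \<open>It suffices to bound the liminf by the rate at each single point \<open>x\<close> of
  \<open>G\<close>; an interval (a, x] inside \<open>G\<close> does this when the rate at
  \<open>x\<close> is finite.\<close>

lemma LDP_lower_bound_T:
  assumes "0 < t"
  shows "LDP_lower_bound (top_of_set {0..1}) M T (rate_I t)"
  unfolding LDP_lower_bound_def
proof (intro allI impI)
  fix G :: "real set" assume G: "openin (top_of_set {0..1}) G"
  then obtain V where V: "open V" "G = {0..1} \<inter> V"
    by (auto simp: openin_open)
  have "- liminf (log_prob_rate M T G) \<le> rate_I t x" if x: "x \<in> G" for x
  \<comment> \<open>As \<open>t\<close> is positive, these are exactly the points of infinite rate,
    where the claim is trivial.\<close>
  proof (cases "x = 0 \<or> t \<noteq> 1 \<and> x = 1")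
    case True
    then have "rate_I t x = \<infinity>"
      using assms by (auto simp: rate_I_def entropy_term_def)
    then show ?thesis by simp
  next
    case False
    then have x01: "0 < x" "x \<le> 1" "t = 1 \<or> x \<noteq> 1"
      using x V by auto
    obtain e where e: "0 < e" "ball x e \<subseteq> V"
      using V x openE by blast
    \<comment> \<open>The maximum keeps the interval inside [0, 1], and \<open>a < x\<close> because
      \<open>x\<close> is positive.\<close>
    define a where "a = max 0 (x - e)"
    have "{a<..x} \<subseteq> G"
      using e x01 V by (auto simp: a_def ball_def dist_real_def subset_iff)
    then have "- rate_I t x \<le> liminf (log_prob_rate M T G)"
      using x01 e V by (intro liminf_log_prob_rate_interval_ge[of a]) (auto simp: a_def assms)
    then show ?thesis
      by (subst (asm) ereal_uminus_le_reorder)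
  qed
  then have "- liminf (log_prob_rate M T G) \<le> (INF x\<in>G. rate_I t x)"
    by (rule INF_greatest)
  then show "- (INF x\<in>G. rate_I t x) \<le> liminf (log_prob_rate M T G)"
    by (subst (asm) ereal_uminus_le_reorder)
qed

end

text \<open>The case \<open>t = 0\<close> is separated because \<open>T n\<close> is then constantly
  0 while the rate is finite on [0, 1). The lower bound fails there, as
  \<open>LDP_lower_bound_fails_at_0\<close> shows, and the remaining properties are
  asserted.\<close>

theorem theorem3p1:
  fixes t :: real
    and M :: "nat \<Rightarrow> 'w measure"
    and U :: "nat \<Rightarrow> nat \<Rightarrow> 'w \<Rightarrow> real"
    and T :: "nat \<Rightarrow> 'w \<Rightarrow> real"
  assumes "0 \<le> t" and "t \<le> 1"
    and "\<And>n. n \<ge> 1 \<Longrightarrow> prob_space (M n)"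
    and "\<And>n. n \<ge> 1 \<Longrightarrow> prob_space.indep_vars (M n) (\<lambda>_. borel) (U n) {1..n}"
    and "\<And>n i. n \<ge> 1 \<Longrightarrow> i \<in> {1..n} \<Longrightarrow>
           distr (M n) borel (U n i) = uniform_measure lborel {0..1}"
    and "\<And>n. n \<ge> 1 \<Longrightarrow> T n = order_statistic (U n) n (nat \<lfloor>real n * t\<rfloor>)"
  shows "good_rate_function (top_of_set {0..1}) (rate_I t) \<and>
         (0 < t \<longrightarrow> satisfies_LDP (top_of_set {0..1}) M T (rate_I t)) \<and>
         (t = 0 \<longrightarrow> (\<forall>n\<ge>1. random_element (top_of_set {0..1}) (M n) (T n)) \<and>
                    LDP_upper_bound (top_of_set {0..1}) M T (rate_I t))"
proof -
  interpret uniform_quantiles t M U T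
  proof (rule uniform_quantiles.intro)
    show "uniform_sample (M n) (U n) n" if "n \<ge> 1" for n
      by (intro uniform_sample.intro uniform_sample_axioms.intro assms that)
  qed (fact assms)+
  show ?thesis
    using good_rate_function_rate_I[OF t] random_element_T LDP_upper_bound_T LDP_lower_bound_T
    by (auto simp: satisfies_LDP_def good_rate_function_def)
qed

end
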